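(* Let $\mathfrak g=\bigoplus_{i}\mathfrak b_i$ be a finite-dimensional Lie algebra over $\mathbb K=\mathbb R$ or $\mathbb C$ graded over $\mathbb Z$. If either (1) the indices $i$ are positive; or (2) the indices $i$ are nonnegative and $\mathfrak b_0$ is $T^*$-solitary, then $\mathfrak g$ is $T^*$-solitary.
   Context: A grading of $\mathfrak g$ over $\mathbb Z$ is a vector space decomposition $\mathfrak g=\bigoplus_{i}\mathfrak b_i$, with $i$ ranging over integers, such that $[\mathfrak b_i,\mathfrak b_j]\subseteq\mathfrak b_{i+j}$; "the indices $i$" are those with $\mathfrak b_i\neq 0$. In particular $\mathfrak b_0$ is a subalgebra. For a linear map $\phi\colon\mathfrak g\to\mathfrak g^*$: its transpose is ${}^t\phi\colon\mathfrak g\to\mathfrak g^*$, ${}^t\phi(X)(Y)=\phi(Y)(X)$; $\phi$ is symmetric if $\phi={}^t\phi$; $\phi$ is ad-invariant if $\phi([X,Y])(Z)=-\phi(Y)([X,Z])$ for all $X,Y,Z\in\mathfrak g$. A linear map $D\colon\mathfrak g\to\mathfrak g^*$ is a derivation if $D([X,Y])(Z)=D(X)([Y,Z])-D(Y)([X,Z])$ for all $X,Y,Z\in\mathfrak g$. A Lie algebra $\mathfrak g$ is $T^*$-solitary if every ad-invariant symmetric linear map $\phi\colon\mathfrak g\to\mathfrak g^*$ can be written as $\phi=D+{}^tD$ for some derivation $D\colon\mathfrak g\to\mathfrak g^*$. *)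

theory Defs
  imports Complex_Main
begin

text \<open>
  Lie algebras live on a subspace \<open>G\<close> of an ambient vector space, so that the definitions below
  apply verbatim both to a Lie algebra and to its subalgebras; \<open>G = UNIV\<close> is allowed.
  The bracket is only constrained on \<open>G\<close>.
\<close>

locale lie_algebra = vector_space scale
  for scale :: "'k::field \<Rightarrow> 'a::ab_group_add \<Rightarrow> 'a" +
  fixes G :: "'a set"
    and br :: "'a \<Rightarrow> 'a \<Rightarrow> 'a"
  assumes subspace_carrier: "subspace G"
    and br_closed: "\<lbrakk>X \<in> G; Y \<in> G\<rbrakk> \<Longrightarrow> br X Y \<in> G"
    and br_add_left: "\<lbrakk>X \<in> G; Y \<in> G; Z \<in> G\<rbrakk> \<Longrightarrow> br (X + Y) Z = br X Z + br Y Z"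
    and br_add_right: "\<lbrakk>X \<in> G; Y \<in> G; Z \<in> G\<rbrakk> \<Longrightarrow> br X (Y + Z) = br X Y + br X Z"
    and br_scale_left: "\<lbrakk>X \<in> G; Y \<in> G\<rbrakk> \<Longrightarrow> br (scale c X) Y = scale c (br X Y)"
    and br_scale_right: "\<lbrakk>X \<in> G; Y \<in> G\<rbrakk> \<Longrightarrow> br X (scale c Y) = scale c (br X Y)"
    and br_self: "X \<in> G \<Longrightarrow> br X X = 0"
    and jacobi: "\<lbrakk>X \<in> G; Y \<in> G; Z \<in> G\<rbrakk> \<Longrightarrow>
      br X (br Y Z) + br Y (br Z X) + br Z (br X Y) = 0"

definition finite_dim :: "('k::field \<Rightarrow> 'a::ab_group_add \<Rightarrow> 'a) \<Rightarrow> 'a set \<Rightarrow> bool" where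
  "finite_dim scale G \<longleftrightarrow> (\<exists>B. finite B \<and> B \<subseteq> G \<and> module.span scale B = G)"

locale int_graded_lie_algebra = lie_algebra scale G br
  for scale :: "'k::field \<Rightarrow> 'a::ab_group_add \<Rightarrow> 'a" and G br +
  fixes b :: "int \<Rightarrow> 'a set"
  assumes subspace_piece: "subspace (b i)"
    and piece_subset: "b i \<subseteq> G"
    and direct_sum: "X \<in> G \<Longrightarrow>
      \<exists>!x. (\<forall>i. x i \<in> b i) \<and> finite {i. x i \<noteq> 0} \<and> X = (\<Sum>i\<in>{i. x i \<noteq> 0}. x i)"
    and br_piece: "\<lbrakk>X \<in> b i; Y \<in> b j\<rbrakk> \<Longrightarrow> br X Y \<in> b (i + j)"

definition grading_indices :: "(int \<Rightarrow> 'a::zero set) \<Rightarrow> int set" where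
  "grading_indices b = {i. b i \<noteq> {0}}"

lemma (in int_graded_lie_algebra) lie_algebra_degree_zero: "lie_algebra scale (b 0) br"
proof unfold_locales
  have G: "X \<in> G" if "X \<in> b 0" for X
    using that piece_subset by blast
  show "br X Y \<in> b 0" if "X \<in> b 0" "Y \<in> b 0" for X Y
    using br_piece[OF that] by simp
qed (use piece_subset[of 0] in \<open>auto simp: subspace_piece subset_iff br_self jacobi
      intro: br_add_left br_add_right br_scale_left br_scale_right\<close>)

text \<open>
  An element of the dual of \<open>G\<close> is represented by any function that is linear on \<open>G\<close>, and a
  map \<open>\<phi>\<close> from \<open>G\<close> to its dual by a curried function, \<open>\<phi> X Y\<close> being the value at \<open>Y\<close> of the
  functional \<open>\<phi> X\<close>. Values at arguments outside \<open>G\<close> carry no information, so equality of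
  functionals, or of maps into the dual, is always equality on \<open>G\<close>.
\<close>

definition dual_on :: "('k::field \<Rightarrow> 'a::ab_group_add \<Rightarrow> 'a) \<Rightarrow> 'a set \<Rightarrow> ('a \<Rightarrow> 'k) set" where
  "dual_on scale G = {f. (\<forall>X\<in>G. \<forall>Y\<in>G. f (X + Y) = f X + f Y) \<and>
                         (\<forall>c. \<forall>X\<in>G. f (scale c X) = c * f X)}"

definition linear_to_dual ::
  "('k::field \<Rightarrow> 'a::ab_group_add \<Rightarrow> 'a) \<Rightarrow> 'a set \<Rightarrow> ('a \<Rightarrow> 'a \<Rightarrow> 'k) \<Rightarrow> bool" where
  "linear_to_dual scale G \<phi> \<longleftrightarrow>
     (\<forall>X\<in>G. \<phi> X \<in> dual_on scale G) \<and>
     (\<forall>X\<in>G. \<forall>Y\<in>G. \<forall>Z\<in>G. \<phi> (X + Y) Z = \<phi> X Z + \<phi> Y Z) \<and>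
     (\<forall>c. \<forall>X\<in>G. \<forall>Z\<in>G. \<phi> (scale c X) Z = c * \<phi> X Z)"

definition dual_transpose :: "('a \<Rightarrow> 'a \<Rightarrow> 'k) \<Rightarrow> 'a \<Rightarrow> 'a \<Rightarrow> 'k" where
  "dual_transpose \<phi> X Y = \<phi> Y X"

definition dual_symmetric :: "'a set \<Rightarrow> ('a \<Rightarrow> 'a \<Rightarrow> 'k) \<Rightarrow> bool" where
  "dual_symmetric G \<phi> \<longleftrightarrow> (\<forall>X\<in>G. \<forall>Y\<in>G. \<phi> X Y = dual_transpose \<phi> X Y)"

definition ad_invariant :: "'a set \<Rightarrow> ('a \<Rightarrow> 'a \<Rightarrow> 'a) \<Rightarrow> ('a \<Rightarrow> 'a \<Rightarrow> 'k::field) \<Rightarrow> bool" where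
  "ad_invariant G br \<phi> \<longleftrightarrow> (\<forall>X\<in>G. \<forall>Y\<in>G. \<forall>Z\<in>G. \<phi> (br X Y) Z = - \<phi> Y (br X Z))"

definition dual_derivation ::
  "('k::field \<Rightarrow> 'a::ab_group_add \<Rightarrow> 'a) \<Rightarrow> 'a set \<Rightarrow> ('a \<Rightarrow> 'a \<Rightarrow> 'a) \<Rightarrow> ('a \<Rightarrow> 'a \<Rightarrow> 'k) \<Rightarrow> bool"
  where
  "dual_derivation scale G br D \<longleftrightarrow> linear_to_dual scale G D \<and>
     (\<forall>X\<in>G. \<forall>Y\<in>G. \<forall>Z\<in>G. D (br X Y) Z = D X (br Y Z) - D Y (br X Z))"

definition Tstar_solitary ::
  "('k::field \<Rightarrow> 'a::ab_group_add \<Rightarrow> 'a) \<Rightarrow> 'a set \<Rightarrow> ('a \<Rightarrow> 'a \<Rightarrow> 'a) \<Rightarrow> bool" where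
  "Tstar_solitary scale G br \<longleftrightarrow>
     (\<forall>\<phi>. linear_to_dual scale G \<phi> \<and> ad_invariant G br \<phi> \<and> dual_symmetric G \<phi> \<longrightarrow>
        (\<exists>D. dual_derivation scale G br D \<and>
             (\<forall>X\<in>G. \<forall>Y\<in>G. \<phi> X Y = D X Y + dual_transpose D X Y)))"

end

theory Submission
  imports Defs
begin

text \<open>
  An ad-invariant symmetric form \<open>\<phi>\<close> satisfies \<open>\<phi> X [Y, Z] = \<phi> [X, Y] Z = - \<phi> Y [X, Z]\<close>. Hence
  rescaling its restriction to \<open>b\<^sub>i \<times> b\<^sub>j\<close> by a weight \<open>w(i, j)\<close> gives a derivation as soon as
  \<open>w(i + j, k) = w(i, j + k) + w(j, i + k)\<close>, and \<open>\<phi>\<close> is that derivation plus its transpose as soon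
  as \<open>w(i, j) + w(j, i) = 1\<close>. Both hold for \<open>w(i, j) = i / (i + j)\<close>. For nonnegative indices the
  only bad pair is \<open>i = j = 0\<close>, where solitariness of \<open>b\<^sub>0\<close> supplies the missing block.
\<close>

section \<open>Homogeneous components and induction over them\<close>

context int_graded_lie_algebra
begin

definition component :: "'a \<Rightarrow> int \<Rightarrow> 'a" where
  "component X = (THE x. (\<forall>i. x i \<in> b i) \<and> finite {i. x i \<noteq> 0} \<and> X = (\<Sum>i\<in>{i. x i \<noteq> 0}. x i))"

abbreviation degrees :: "'a \<Rightarrow> int set" where
  "degrees X \<equiv> {i. component X i \<noteq> 0}"

lemma component:
  assumes "X \<in> G"
  shows component_in: "component X i \<in> b i"
    and finite_degrees: "finite (degrees X)"
    and sum_component: "(\<Sum>i\<in>degrees X. component X i) = X"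
  using theI'[OF direct_sum[OF assms]] unfolding component_def by auto

text \<open>Uniqueness in \<open>direct_sum\<close> concerns the sum over the exact support. Zero
  summands are harmless, so a candidate may be tested on any finite \<open>A\<close> containing its
  support.\<close>

lemma component_eqI:
  assumes X: "X \<in> G" and x: "\<And>i. x i \<in> b i" and A: "finite A" "\<And>i. i \<notin> A \<Longrightarrow> x i = 0"
    and sum: "X = (\<Sum>i\<in>A. x i)"
  shows "component X = x"
  unfolding component_def
proof (rule the1_equality[OF direct_sum[OF X]], intro conjI allI x)
  have sub: "{i. x i \<noteq> 0} \<subseteq> A"
    using A(2) by blast
  then show "finite {i. x i \<noteq> 0}"
    using A(1) finite_subset by blast
  show "X = (\<Sum>i\<in>{i. x i \<noteq> 0}. x i)"
    unfolding sum by (rule sum.mono_neutral_right[OF A(1) sub]) auto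
qed

lemma piece_zero: "0 \<in> b i"
  using subspace_piece subspace_0 by blast

lemma in_carrier: "X \<in> b i \<Longrightarrow> X \<in> G"
  using piece_subset by blast

lemma component_sum:
  assumes "X \<in> G" "finite A" "degrees X \<subseteq> A"
  shows "X = (\<Sum>i\<in>A. component X i)"
proof -
  have "(\<Sum>i\<in>degrees X. component X i) = (\<Sum>i\<in>A. component X i)"
    by (rule sum.mono_neutral_left) (use assms in auto)
  then show ?thesis
    by (simp add: sum_component[OF assms(1)])
qed

lemma component_homogeneous:
  assumes "X \<in> b i"
  shows "component X = (\<lambda>j. if j = i then X else 0)"
  by (rule component_eqI[where A = "{i}"]) (use assms in \<open>auto simp: in_carrier piece_zero\<close>)

lemma component_add:
  assumes X: "X \<in> G" and Y: "Y \<in> G"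
  shows "component (X + Y) = (\<lambda>i. component X i + component Y i)"
proof (rule component_eqI[where A = "degrees X \<union> degrees Y"])
  \<comment> \<open>Cancellation can remove degrees from \<open>X + Y\<close>, so the union only
    contains its support; \<open>component_eqI\<close> allows this.\<close>
  let ?A = "degrees X \<union> degrees Y"
  have fin: "finite ?A"
    using X Y by (simp add: finite_degrees)
  then show "X + Y = (\<Sum>i\<in>?A. component X i + component Y i)"
    using component_sum[OF X fin] component_sum[OF Y fin] by (simp add: sum.distrib)
qed (use X Y in \<open>auto simp: component_in finite_degrees
      intro: subspace_add[OF subspace_piece] subspace_add[OF subspace_carrier]\<close>)

lemma component_scale:
  assumes X: "X \<in> G"
  shows "component (scale c X) = (\<lambda>i. scale c (component X i))"
proof (rule component_eqI[where A = "degrees X"])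
  show "scale c X = (\<Sum>i\<in>degrees X. scale c (component X i))"
    using sum_component[OF X] by (metis scale_sum_right)
qed (use X in \<open>auto simp: component_in finite_degrees
      intro: subspace_scale[OF subspace_piece] subspace_scale[OF subspace_carrier]\<close>)

text \<open>Every element of \<open>G\<close> is a finite sum of its nonzero components. The
  homogeneous case retains \<open>X \<noteq> 0\<close> so that \<open>i\<close> is a genuine grading
  index, to which sign conditions on the indices apply.\<close>

lemma graded_induct [consumes 1, case_names zero add homogeneous]:
  assumes X: "X \<in> G"
    and zero: "P 0"
    and add: "\<And>X Y. \<lbrakk>X \<in> G; Y \<in> G; P X; P Y\<rbrakk> \<Longrightarrow> P (X + Y)"
    and hom: "\<And>i X. \<lbrakk>X \<in> b i; X \<noteq> 0\<rbrakk> \<Longrightarrow> P X"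
  shows "P X"
proof -
  \<comment> \<open>Membership of the partial sums in \<open>G\<close> is carried along because the
    additive case requires it.\<close>
  have "(\<Sum>i\<in>A. component X i) \<in> G \<and> P (\<Sum>i\<in>A. component X i)"
    if "finite A" "A \<subseteq> degrees X" for A
    using that
  proof (induction A rule: finite_induct)
    case empty
    then show ?case
      using zero subspace_0[OF subspace_carrier] by simp
  next
    case (insert i A)
    have i: "component X i \<in> b i" "component X i \<noteq> 0"
      using insert.prems component_in[OF X] by auto
    then show ?case
      using insert hom[OF i] add[OF in_carrier[OF i(1)]]
        subspace_add[OF subspace_carrier in_carrier[OF i(1)]] by simp
  qed
  then show ?thesis
    using finite_degrees[OF X] sum_component[OF X] by (metis order_refl)
qed

section \<open>Bilinear forms assembled from homogeneous blocks\<close>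

text \<open>\<open>\<psi> i j\<close> is the block on \<open>b i \<times> b j\<close>; its values
  elsewhere never enter when \<open>X\<close> and \<open>Y\<close> lie in \<open>G\<close>.\<close>

definition glue :: "(int \<Rightarrow> int \<Rightarrow> 'a \<Rightarrow> 'a \<Rightarrow> 'k) \<Rightarrow> 'a \<Rightarrow> 'a \<Rightarrow> 'k" where
  "glue \<psi> X Y = (\<Sum>i\<in>degrees X. \<Sum>j\<in>degrees Y. \<psi> i j (component X i) (component Y j))"

context
  fixes \<psi> :: "int \<Rightarrow> int \<Rightarrow> 'a \<Rightarrow> 'a \<Rightarrow> 'k"
  assumes block_add_left: "\<And>i j x x' y. \<lbrakk>x \<in> b i; x' \<in> b i; y \<in> b j\<rbrakk> \<Longrightarrow>
      \<psi> i j (x + x') y = \<psi> i j x y + \<psi> i j x' y"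
    and block_add_right: "\<And>i j x y y'. \<lbrakk>x \<in> b i; y \<in> b j; y' \<in> b j\<rbrakk> \<Longrightarrow>
      \<psi> i j x (y + y') = \<psi> i j x y + \<psi> i j x y'"
    and block_scale_left: "\<And>i j c x y. \<lbrakk>x \<in> b i; y \<in> b j\<rbrakk> \<Longrightarrow>
      \<psi> i j (scale c x) y = c * \<psi> i j x y"
    and block_scale_right: "\<And>i j c x y. \<lbrakk>x \<in> b i; y \<in> b j\<rbrakk> \<Longrightarrow>
      \<psi> i j x (scale c y) = c * \<psi> i j x y"
begin

text \<open>The supports vary with the arguments. Padding them to common index sets lets glued
  values be compared term by term.\<close>

lemma glue_eq_sum:
  assumes X: "X \<in> G" and Y: "Y \<in> G" and A: "finite A" "degrees X \<subseteq> A"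
    and B: "finite B" "degrees Y \<subseteq> B"
  shows "glue \<psi> X Y = (\<Sum>i\<in>A. \<Sum>j\<in>B. \<psi> i j (component X i) (component Y j))"
proof -
  \<comment> \<open>Each padding term has a zero argument, and homogeneity with scalar 0 makes the
    block vanish there.\<close>
  have left0: "\<psi> i j 0 y = 0" if "y \<in> b j" for i j y
    using block_scale_left[OF piece_zero that, of i 0] by simp
  have right0: "\<psi> i j x 0 = 0" if "x \<in> b i" for i j x
    using block_scale_right[OF that piece_zero, of j 0] by simp
  have "glue \<psi> X Y = (\<Sum>i\<in>degrees X. \<Sum>j\<in>B. \<psi> i j (component X i) (component Y j))"
    unfolding glue_def
    by (intro sum.cong sum.mono_neutral_left B refl) (auto simp: right0 component_in[OF X])
  also have "\<dots> = (\<Sum>i\<in>A. \<Sum>j\<in>B. \<psi> i j (component X i) (component Y j))"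
    by (intro sum.mono_neutral_left A) (auto simp: left0 component_in[OF Y])
  finally show ?thesis .
qed

lemma glue_homogeneous:
  assumes "X \<in> b i" "Y \<in> b j"
  shows "glue \<psi> X Y = \<psi> i j X Y"
proof -
  \<comment> \<open>Only inclusions hold, since a zero argument has empty support.\<close>
  have "degrees X \<subseteq> {i}" "degrees Y \<subseteq> {j}"
    using assms by (auto simp: component_homogeneous)
  then have "glue \<psi> X Y = (\<Sum>i'\<in>{i}. \<Sum>j'\<in>{j}. \<psi> i' j' (component X i') (component Y j'))"
    using assms by (intro glue_eq_sum) (auto simp: in_carrier)
  then show ?thesis
    using assms by (simp add: component_homogeneous)
qed

lemma linear_to_dual_glue: "linear_to_dual scale G (glue \<psi>)"
proof -
  have add_left: "glue \<psi> (X + Y) Z = glue \<psi> X Z + glue \<psi> Y Z"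
    and add_right: "glue \<psi> Z (X + Y) = glue \<psi> Z X + glue \<psi> Z Y"
    if XYZ: "X \<in> G" "Y \<in> G" "Z \<in> G" for X Y Z
  proof -
    \<comment> \<open>This set contains the supports of \<open>X\<close>, \<open>Y\<close> and
      \<open>X + Y\<close>, so additivity of the blocks can be summed termwise.\<close>
    let ?A = "degrees X \<union> degrees Y"
    have A: "finite ?A" "degrees X \<subseteq> ?A" "degrees Y \<subseteq> ?A"
      "{i. component X i + component Y i \<noteq> 0} \<subseteq> ?A"
      "X + Y \<in> G"
      using XYZ by (auto simp: finite_degrees component_add subspace_add[OF subspace_carrier])
    note eqs = glue_eq_sum[where A = ?A and B = "degrees Z"] glue_eq_sum[where A = "degrees Z" and B = ?A]
    show "glue \<psi> (X + Y) Z = glue \<psi> X Z + glue \<psi> Y Z"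
      by (simp add: eqs XYZ A finite_degrees component_add component_in block_add_left sum.distrib)
    show "glue \<psi> Z (X + Y) = glue \<psi> Z X + glue \<psi> Z Y"
      by (simp add: eqs XYZ A finite_degrees component_add component_in block_add_right sum.distrib)
  qed
  have scale_left: "glue \<psi> (scale c X) Z = c * glue \<psi> X Z"
    and scale_right: "glue \<psi> Z (scale c X) = c * glue \<psi> Z X"
    if XZ: "X \<in> G" "Z \<in> G" for c X Z
  proof -
    \<comment> \<open>Scaling never enlarges the support, and \<open>c = 0\<close> empties it;
      \<open>degrees X\<close> therefore serves both sides.\<close>
    have A: "{i. c \<noteq> 0 \<and> component X i \<noteq> 0} \<subseteq> degrees X" "scale c X \<in> G"
      using XZ by (auto simp: component_scale subspace_scale[OF subspace_carrier])
    note eqs = glue_eq_sum[where A = "degrees X" and B = "degrees Z"]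
      glue_eq_sum[where A = "degrees Z" and B = "degrees X"]
    show "glue \<psi> (scale c X) Z = c * glue \<psi> X Z"
      by (simp add: eqs XZ A finite_degrees component_scale component_in block_scale_left sum_distrib_left)
    show "glue \<psi> Z (scale c X) = c * glue \<psi> Z X"
      by (simp add: eqs XZ A finite_degrees component_scale component_in block_scale_right sum_distrib_left)
  qed
  show ?thesis
    unfolding linear_to_dual_def dual_on_def
    using add_left add_right scale_left scale_right by auto
qed

end

section \<open>Reduction of identities to homogeneous arguments\<close>

lemma linear_to_dualD:
  assumes "linear_to_dual scale H \<phi>"
  shows "\<lbrakk>X \<in> H; Y \<in> H; Z \<in> H\<rbrakk> \<Longrightarrow> \<phi> (X + Y) Z = \<phi> X Z + \<phi> Y Z"
    and "\<lbrakk>X \<in> H; Y \<in> H; Z \<in> H\<rbrakk> \<Longrightarrow> \<phi> X (Y + Z) = \<phi> X Y + \<phi> X Z"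
    and "\<lbrakk>X \<in> H; Z \<in> H\<rbrakk> \<Longrightarrow> \<phi> (scale c X) Z = c * \<phi> X Z"
    and "\<lbrakk>X \<in> H; Z \<in> H\<rbrakk> \<Longrightarrow> \<phi> X (scale c Z) = c * \<phi> X Z"
  using assms by (auto simp: linear_to_dual_def dual_on_def)

lemma linear_to_dual_zero:
  assumes "linear_to_dual scale G \<phi>" "X \<in> G"
  shows "\<phi> 0 X = 0" "\<phi> X 0 = 0"
  using linear_to_dualD(3)[OF assms(1), of X X 0] linear_to_dualD(4)[OF assms(1), of X X 0] assms(2)
  by auto

lemma br_zero:
  assumes "X \<in> G"
  shows "br 0 X = 0" "br X 0 = 0"
  using br_scale_left[of X X 0] br_scale_right[of X X 0] assms by auto

text \<open>Both sides of the derivation identity are trilinear on \<open>G\<close>, so three nested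
  graded inductions reduce it to nonzero homogeneous arguments.\<close>

lemma dual_derivationI_homogeneous:
  assumes D: "linear_to_dual scale G D"
    and hom: "\<And>i j k X Y Z. \<lbrakk>X \<in> b i; Y \<in> b j; Z \<in> b k; X \<noteq> 0; Y \<noteq> 0; Z \<noteq> 0\<rbrakk> \<Longrightarrow>
      D (br X Y) Z = D X (br Y Z) - D Y (br X Z)"
  shows "dual_derivation scale G br D"
proof -
  note simps = linear_to_dualD[OF D] linear_to_dual_zero[OF D] br_zero br_closed
    br_add_left br_add_right in_carrier subspace_0[OF subspace_carrier]
    subspace_add[OF subspace_carrier]
  have "D (br X Y) Z = D X (br Y Z) - D Y (br X Z)" if "X \<in> G" "Y \<in> G" "Z \<in> G" for X Y Z
    using that
  proof (induction X rule: graded_induct)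
    case (homogeneous i X)
    from homogeneous(3,4,1,2) show ?case
    proof (induction Y rule: graded_induct)
      case (homogeneous j Y)
      from homogeneous(3,1,2,4,5) show ?case
        by (induction Z rule: graded_induct) (auto simp: simps intro: hom)
    qed (simp_all add: simps)
  qed (simp_all add: simps)
  then show ?thesis
    using D by (simp add: dual_derivation_def)
qed

lemma bilinear_eqI_homogeneous:
  assumes \<phi>: "linear_to_dual scale G \<phi>" and \<psi>: "linear_to_dual scale G \<psi>"
    and hom: "\<And>i j X Y. \<lbrakk>X \<in> b i; Y \<in> b j; X \<noteq> 0; Y \<noteq> 0\<rbrakk> \<Longrightarrow> \<phi> X Y = \<psi> X Y"
    and "X \<in> G" "Y \<in> G"
  shows "\<phi> X Y = \<psi> X Y"
  using assms(4,5)
proof (induction X rule: graded_induct)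
  case (homogeneous i X)
  from homogeneous(3,1,2) show ?case
    by (induction Y rule: graded_induct)
      (auto simp: in_carrier linear_to_dualD[OF \<phi>] linear_to_dualD[OF \<psi>]
        linear_to_dual_zero[OF \<phi>] linear_to_dual_zero[OF \<psi>] intro: hom)
qed (simp_all add: linear_to_dualD[OF \<phi>] linear_to_dualD[OF \<psi>]
    linear_to_dual_zero[OF \<phi>] linear_to_dual_zero[OF \<psi>])

end

section \<open>Solitariness of graded Lie algebras\<close>

text \<open>Linearity forces \<open>\<phi> 0 0 = 0\<close>, so the zero derivation works. This
  covers the degree zero piece when all indices are positive.\<close>

lemma (in vector_space) Tstar_solitary_trivial: "Tstar_solitary scale {0} br"
  unfolding Tstar_solitary_def
proof (intro allI impI)
  fix \<phi> :: "'b \<Rightarrow> 'b \<Rightarrow> 'a"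
  assume "linear_to_dual scale {0} \<phi> \<and> ad_invariant {0} br \<phi> \<and> dual_symmetric {0} \<phi>"
  then have "\<phi> 0 0 = 0"
    by (metis linear_to_dual_def insertI1 mult_zero_left scale_zero_left)
  then show "\<exists>D. dual_derivation scale {0} br D \<and> (\<forall>X\<in>{0}. \<forall>Y\<in>{0}. \<phi> X Y = D X Y + dual_transpose D X Y)"
    by (intro exI[of _ "\<lambda>_ _. 0"] conjI ballI)
      (simp_all add: dual_derivation_def linear_to_dual_def dual_on_def dual_transpose_def)
qed

text \<open>Characteristic zero makes every nonzero integer \<open>i + j\<close> invertible in the
  field, as the weights \<open>i / (i + j)\<close> demand.\<close>

theorem Tstar_solitary_if_nonneg_graded:
  fixes scale :: "'k::field_char_0 \<Rightarrow> 'a::ab_group_add \<Rightarrow> 'a"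
  assumes "int_graded_lie_algebra scale G br b"
    and nonneg: "\<forall>i\<in>grading_indices b. 0 \<le> i"
    and solitary: "Tstar_solitary scale (b 0) br"
  shows "Tstar_solitary scale G br"
  unfolding Tstar_solitary_def
proof (intro allI impI, elim conjE)
  interpret int_graded_lie_algebra scale G br b by fact
  fix \<phi> :: "'a \<Rightarrow> 'a \<Rightarrow> 'k"
  assume lin: "linear_to_dual scale G \<phi>" and inv: "ad_invariant G br \<phi>"
    and sym: "dual_symmetric G \<phi>"
  note \<phi>_simps = linear_to_dualD[OF lin]
  have commute: "\<phi> X Y = \<phi> Y X" if "X \<in> G" "Y \<in> G" for X Y
    using sym that by (simp add: dual_symmetric_def dual_transpose_def)
  have inv_left: "\<phi> Y (br X Z) = - \<phi> (br X Y) Z" if "X \<in> G" "Y \<in> G" "Z \<in> G" for X Y Z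
    using inv that by (simp add: ad_invariant_def)
  \<comment> \<open>With \<open>inv_left\<close>, this turns every term of the derivation identity
    into a multiple of the single scalar \<open>\<phi> (br X Y) Z\<close>.\<close>
  have inv_right: "\<phi> X (br Y Z) = \<phi> (br X Y) Z" if XYZ: "X \<in> G" "Y \<in> G" "Z \<in> G" for X Y Z
  proof -
    have "\<phi> X (br Y Z) = \<phi> (br Y Z) X"
      using XYZ by (simp add: commute br_closed)
    also have "\<dots> = - \<phi> Z (br Y X)"
      using XYZ inv_left[of Y Z X] by simp
    also have "br Y X = - br X Y"
    proof -
      \<comment> \<open>Polarising \<open>br_self\<close> yields antisymmetry of the
        bracket.\<close>
      have "br (X + Y) (X + Y) = br X Y + br Y X"
        using XYZ by (subst br_add_left; simp add: br_add_right br_self subspace_add[OF subspace_carrier])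
      moreover have "br (X + Y) (X + Y) = 0"
        using XYZ by (intro br_self subspace_add[OF subspace_carrier])
      ultimately have "br X Y + br Y X = 0"
        by simp
      then show ?thesis
        by (metis add.commute eq_neg_iff_add_eq_0)
    qed
    also have "- \<phi> Z (- br X Y) = \<phi> Z (br X Y)"
      using XYZ \<phi>_simps(4)[of Z "br X Y" "-1"] by (simp add: br_closed)
    finally show ?thesis
      using XYZ by (simp add: commute br_closed)
  qed
  have "linear_to_dual scale (b 0) \<phi> \<and> ad_invariant (b 0) br \<phi> \<and> dual_symmetric (b 0) \<phi>"
    using lin inv sym in_carrier
    unfolding linear_to_dual_def dual_on_def ad_invariant_def dual_symmetric_def by blast
  then obtain D0 where D0: "dual_derivation scale (b 0) br D0"
    and \<phi>0: "\<forall>X\<in>b 0. \<forall>Y\<in>b 0. \<phi> X Y = D0 X Y + D0 Y X"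
    using solitary by (auto simp: Tstar_solitary_def dual_transpose_def)
  have lin0: "linear_to_dual scale (b 0) D0"
    and der0: "\<And>X Y Z. \<lbrakk>X \<in> b 0; Y \<in> b 0; Z \<in> b 0\<rbrakk> \<Longrightarrow>
      D0 (br X Y) Z = D0 X (br Y Z) - D0 Y (br X Z)"
    using D0 by (auto simp: dual_derivation_def)
  \<comment> \<open>\<open>D0\<close> replaces the undefined weight 0/0. For
    \<open>i + j = 0\<close> with \<open>i \<noteq> 0\<close>, division by zero gives the zero
    block; it is still bilinear and, the indices being nonnegative, never meets two nonzero
    homogeneous arguments.\<close>
  define \<psi> where "\<psi> i j = (if i = 0 \<and> j = 0 then D0 else
      (\<lambda>X Y. of_int i / of_int (i + j) * \<phi> X Y))" for i j
  define D where "D = glue \<psi>"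
  have \<psi>: "\<lbrakk>x \<in> b i; x' \<in> b i; y \<in> b j\<rbrakk> \<Longrightarrow> \<psi> i j (x + x') y = \<psi> i j x y + \<psi> i j x' y"
    "\<lbrakk>x \<in> b i; y \<in> b j; y' \<in> b j\<rbrakk> \<Longrightarrow> \<psi> i j x (y + y') = \<psi> i j x y + \<psi> i j x y'"
    "\<lbrakk>x \<in> b i; y \<in> b j\<rbrakk> \<Longrightarrow> \<psi> i j (scale c x) y = c * \<psi> i j x y"
    "\<lbrakk>x \<in> b i; y \<in> b j\<rbrakk> \<Longrightarrow> \<psi> i j x (scale c y) = c * \<psi> i j x y" for i j x x' y y' c
    by (auto simp: \<psi>_def linear_to_dualD[OF lin0] \<phi>_simps in_carrier distrib_left)
  have linD: "linear_to_dual scale G D"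
    unfolding D_def by (rule linear_to_dual_glue) (fact \<psi>)+
  have D_hom: "D X Y = \<psi> i j X Y" if "X \<in> b i" "Y \<in> b j" for i j X Y
    unfolding D_def by (rule glue_homogeneous) (fact \<psi> that)+
  have index: "0 \<le> i" if "X \<in> b i" "X \<noteq> 0" for i X
    using nonneg that by (auto simp: grading_indices_def)
  have "dual_derivation scale G br D"
  proof (rule dual_derivationI_homogeneous[OF linD])
    fix i j k X Y Z
    assume XYZ: "X \<in> b i" "Y \<in> b j" "Z \<in> b k" and nz: "X \<noteq> 0" "Y \<noteq> 0" "Z \<noteq> 0"
    note pieces = br_piece[OF XYZ(1,2)] br_piece[OF XYZ(2,3)] br_piece[OF XYZ(1,3)]
    have ge: "0 \<le> i" "0 \<le> j" "0 \<le> k"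
      using index XYZ nz by auto
    show "D (br X Y) Z = D X (br Y Z) - D Y (br X Z)"
    proof (cases "i = 0 \<and> j = 0 \<and> k = 0")
      \<comment> \<open>All brackets stay in \<open>b 0\<close>, so this is the derivation identity
        of \<open>D0\<close>.\<close>
      case True
      then show ?thesis
        using XYZ pieces der0 by (simp add: D_hom[of _ 0 _ 0] \<psi>_def)
    next
      case False
      \<comment> \<open>All three terms pair pieces of total degree \<open>?s\<close>, which is
        nonzero, so none uses the \<open>D0\<close> block and the weights share one
        denominator.\<close>
      let ?s = "of_int (i + j + k) :: 'k"
      have "i + j + k \<noteq> 0"
        using False ge by linarith
      then have s: "?s \<noteq> 0"
        by (metis of_int_eq_0_iff)
      have "D (br X Y) Z = of_int (i + j) / ?s * \<phi> (br X Y) Z"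
        using False ge D_hom[OF pieces(1) XYZ(3)] by (auto simp: \<psi>_def)
      moreover have "D X (br Y Z) = of_int i / ?s * \<phi> (br X Y) Z"
        using False ge D_hom[OF XYZ(1) pieces(2)] XYZ
        by (auto simp: \<psi>_def inv_right in_carrier add.assoc)
      \<comment> \<open>The sign from \<open>inv_left\<close> turns the subtraction into addition,
        leaving \<open>(i + j) / ?s = i / ?s + j / ?s\<close>.\<close>
      moreover have "D Y (br X Z) = - (of_int j / ?s * \<phi> (br X Y) Z)"
        using False ge D_hom[OF XYZ(2) pieces(3)] XYZ
        by (auto simp: \<psi>_def inv_left in_carrier ac_simps)
      ultimately show ?thesis
        by (simp add: add_divide_distrib distrib_right)
    qed
  qed
  moreover have "\<phi> X Y = D X Y + dual_transpose D X Y" if "X \<in> G" "Y \<in> G" for X Y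
  proof (rule bilinear_eqI_homogeneous[OF lin _ _ that])
    show "linear_to_dual scale G (\<lambda>X Y. D X Y + dual_transpose D X Y)"
      using linD by (simp add: linear_to_dual_def dual_on_def dual_transpose_def distrib_left)
    fix i j X Y
    assume XY: "X \<in> b i" "Y \<in> b j" and nz: "X \<noteq> 0" "Y \<noteq> 0"
    have ge: "0 \<le> i" "0 \<le> j"
      using index XY nz by auto
    show "\<phi> X Y = D X Y + dual_transpose D X Y"
    proof (cases "i = 0 \<and> j = 0")
      case True
      then show ?thesis
        using XY \<phi>0 by (simp add: dual_transpose_def D_hom[of _ 0 _ 0] \<psi>_def)
    next
      case False
      then have "i + j \<noteq> 0"
        using ge by linarith
      then have s: "of_int (i + j) \<noteq> (0::'k)"
        by (metis of_int_eq_0_iff)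
      \<comment> \<open>The transposed term lies in block \<open>(j, i)\<close>; symmetry of
        \<open>\<phi>\<close> lets the two weights be added.\<close>
      have "D X Y + D Y X = (of_int i / of_int (i + j) + of_int j / of_int (i + j)) * \<phi> X Y"
        using False XY D_hom[OF XY] D_hom[OF XY(2,1)] commute[of Y X]
        by (auto simp: \<psi>_def in_carrier distrib_right add.commute)
      also have "of_int i / of_int (i + j) + of_int j / of_int (i + j) = (1::'k)"
        using s by (simp flip: add_divide_distrib)
      finally show ?thesis
        by (simp add: dual_transpose_def)
    qed
  qed
  ultimately show "\<exists>D. dual_derivation scale G br D \<and>
      (\<forall>X\<in>G. \<forall>Y\<in>G. \<phi> X Y = D X Y + dual_transpose D X Y)"
    by blast
qed

corollary Tstar_solitary_if_graded:
  fixes scale :: "'k::field_char_0 \<Rightarrow> 'a::ab_group_add \<Rightarrow> 'a"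
  assumes "int_graded_lie_algebra scale G br b"
    and "(\<forall>i\<in>grading_indices b. 0 < i) \<or>
      ((\<forall>i\<in>grading_indices b. 0 \<le> i) \<and> Tstar_solitary scale (b 0) br)"
  shows "Tstar_solitary scale G br"
proof -
  interpret int_graded_lie_algebra scale G br b by fact
  \<comment> \<open>If 0 is not an index then \<open>b 0\<close> is the zero space, so the positive
    case becomes an instance of the nonnegative one.\<close>
  have "Tstar_solitary scale (b 0) br" if "\<forall>i\<in>grading_indices b. 0 < i"
  proof -
    have "b 0 = {0}"
      using that by (auto simp: grading_indices_def)
    then show ?thesis
      by (simp add: Tstar_solitary_trivial)
  qed
  then show ?thesis
    using assms by (intro Tstar_solitary_if_nonneg_graded[OF assms(1)]) force+
qed

theorem proposition5p13:
  shows "(\<forall>(scale :: real \<Rightarrow> 'a::ab_group_add \<Rightarrow> 'a) G br b.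
            int_graded_lie_algebra scale G br b \<longrightarrow> finite_dim scale G \<longrightarrow>
            (\<forall>i\<in>grading_indices b. 0 < i) \<or>
            ((\<forall>i\<in>grading_indices b. 0 \<le> i) \<and> Tstar_solitary scale (b 0) br) \<longrightarrow>
            Tstar_solitary scale G br) \<and>
         (\<forall>(scale :: complex \<Rightarrow> 'b::ab_group_add \<Rightarrow> 'b) G br b.
            int_graded_lie_algebra scale G br b \<longrightarrow> finite_dim scale G \<longrightarrow>
            (\<forall>i\<in>grading_indices b. 0 < i) \<or>
            ((\<forall>i\<in>grading_indices b. 0 \<le> i) \<and> Tstar_solitary scale (b 0) br) \<longrightarrow>
            Tstar_solitary scale G br)"
  \<comment> \<open>Both \<open>real\<close> and \<open>complex\<close> have characteristic zero, so
    the same corollary settles each conjunct.\<close>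
  by (intro conjI allI impI) (erule (1) Tstar_solitary_if_graded)+

end
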